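(* In dimension $d=2$, there exist $\kappa>0$ and $C>0$ such that $$\forall r>1,\quad |Q(r)-\kappa K_0(r)|\le C\,\frac{e^{-2r}}{r}.$$ In dimension $d=3$, there exist $\kappa>0$ and $C>0$ such that $$\forall r>1,\quad \Big|Q(r)-\kappa\frac{e^{-r}}{r}\Big|\le C\,\frac{e^{-r}}{r^2}.$$
   Context: $Q$ is the ground state in $\mathbb R^d$: the unique smooth positive radial solution, tending to $0$ at infinity, of $-\Delta Q+Q-Q^2=0$ on $\mathbb R^d$; it is identified with a function of $r=|\mathbf x|$. $K_0$ is the modified Bessel function of the second kind of order $0$ (the positive decaying solution of $f''+\frac1rf'-f=0$ on $(0,\infty)$ with $K_0(r)\sim\sqrt{\pi/2}\,r^{-1/2}e^{-r}$ as $r\to\infty$). *)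

theory Defs
  imports "HOL-Analysis.Analysis" "HOL-Library.Landau_Symbols"
begin

definition partial_deriv :: "'a::euclidean_space \<Rightarrow> ('a \<Rightarrow> real) \<Rightarrow> 'a \<Rightarrow> real" where
  "partial_deriv b f x = frechet_derivative f (at x) b"

definition laplacian :: "('a::euclidean_space \<Rightarrow> real) \<Rightarrow> 'a \<Rightarrow> real" where
  "laplacian f x = (\<Sum>b\<in>Basis. partial_deriv b (partial_deriv b f) x)"

text \<open>
  Smoothness (of class \<open>C\<^sup>\<infinity>\<close>) on the whole space: all iterated partial derivatives, including \<open>f\<close>
  itself (empty list), are Frechet differentiable everywhere. They are then all continuous.
\<close>

definition smooth :: "('a::euclidean_space \<Rightarrow> real) \<Rightarrow> bool" where
  "smooth f \<longleftrightarrow>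
     (\<forall>bs. set bs \<subseteq> Basis \<longrightarrow> (\<forall>x. foldr partial_deriv bs f differentiable (at x)))"

definition radial_profile :: "('a::euclidean_space \<Rightarrow> real) \<Rightarrow> (real \<Rightarrow> real) \<Rightarrow> bool" where
  "radial_profile Q q \<longleftrightarrow> (\<forall>x. Q x = q (norm x))"

definition ground_state :: "('a::euclidean_space \<Rightarrow> real) \<Rightarrow> bool" where
  "ground_state Q \<longleftrightarrow>
     smooth Q \<and> (\<forall>x. Q x > 0) \<and> (\<exists>q. radial_profile Q q) \<and> (Q \<longlongrightarrow> 0) at_infinity \<and>
     (\<forall>x. - laplacian Q x + Q x - (Q x)\<^sup>2 = 0)"

text \<open>
  The modified Bessel function \<open>K\<^sub>0\<close>, characterised on \<open>(0,\<infinity>)\<close> by its differential equation and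
  its behaviour at infinity; the asymptotic equivalence fixes the multiplicative constant, so any
  two functions satisfying this predicate agree on \<open>(0,\<infinity>)\<close>. Values at \<open>r \<le> 0\<close> are irrelevant.
\<close>

definition is_bessel_K0 :: "(real \<Rightarrow> real) \<Rightarrow> bool" where
  "is_bessel_K0 f \<longleftrightarrow>
     (\<exists>f' f''. \<forall>r>0. (f has_real_derivative f' r) (at r) \<and>
        (f' has_real_derivative f'' r) (at r) \<and> f'' r + 1 / r * f' r - f r = 0) \<and>
     (\<forall>r>0. f r > 0) \<and> (f \<longlongrightarrow> 0) at_top \<and>
     f \<sim>[at_top] (\<lambda>r. sqrt (pi / 2) * r powr (-1/2) * exp (- r))"

end

theory Submission
  imports Defs "HOL-Real_Asymp.Real_Asymp"
begin

text \<open>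
  The profile \<open>q\<close> of a ground state solves \<open>q'' + (d - 1) / r * q' = q - q\<^sup>2\<close>, and the comparison function
  \<open>K\<close> (\<open>K\<^sub>0\<close> for \<open>d = 2\<close>, \<open>exp (-r) / r\<close> for \<open>d = 3\<close>) solves the linear part of this equation. With
  \<open>m = (d - 1) / 2\<close>, the substitutions \<open>v = r powr m * q\<close> and \<open>k = r powr m * K\<close> remove the first-order
  terms (\<open>liouville_transform\<close>): \<open>v'' = (h - q) v\<close> and \<open>k'' = h k\<close> with \<open>h = 1 + m (m - 1) / r\<^sup>2\<close>.

  Everything then follows from the Wronskian \<open>W = v' k - v k'\<close> and the quotient \<open>u = v / k\<close>, for which
  \<open>W' = - q v k\<close> and \<open>u' = W / k\<^sup>2\<close>. A convexity argument shows that \<open>v\<close>, \<open>k\<close> and their derivatives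
  vanish at infinity, with \<open>v = O(exp (-3 r / 4))\<close> (\<open>positive_sublinear_solution_decay\<close>). So \<open>W\<close> tends
  to \<open>0\<close>, is nonnegative, and is the tail integral of \<open>q v k\<close>; in particular \<open>u\<close> increases. The crude
  decay of \<open>v\<close> already gives \<open>W = O(exp (-5 r / 2))\<close>, hence \<open>u' = O(exp (-r / 2))\<close>, so \<open>u\<close> has a finite
  limit \<open>\<kappa>\<close>, which is positive because \<open>u\<close> is positive and increasing. Now \<open>v \<le> \<kappa> k = O(exp (-r))\<close>,
  and feeding this back gives \<open>W = O(r powr (-m) * exp (-3 r))\<close> and
  \<open>0 \<le> \<kappa> - u = O(r powr (-m) * exp (-r))\<close>. Multiplying by \<open>K\<close> yields
  \<open>q - \<kappa> K = O(r powr (-2 m) * exp (-2 r))\<close>, which is the claim for \<open>d = 2\<close> and more than the claim for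
  \<open>d = 3\<close>.
\<close>

section \<open>Monotone functions at infinity\<close>

text \<open>
  The substitute for integrating a differential inequality from \<open>r\<close> to infinity.
\<close>

lemma le_limit_of_deriv_nonneg:
  fixes F F' :: "real \<Rightarrow> real"
  assumes "\<And>r. r \<ge> R \<Longrightarrow> (F has_real_derivative F' r) (at r)"
    and "\<And>r. r \<ge> R \<Longrightarrow> F' r \<ge> 0"
    and "(F \<longlongrightarrow> L) at_top" and "r \<ge> R"
  shows "F r \<le> L"
proof (rule tendsto_lowerbound[OF assms(3)])
  show "\<forall>\<^sub>F t in at_top. F r \<le> F t"
    using eventually_ge_at_top[of r]
  proof eventually_elim
    case (elim t)
    show ?case
      by (rule DERIV_nonneg_imp_nondecreasing[OF elim])
        (meson assms(1,2,4) order_trans)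
  qed
qed simp

lemma bounded_increasing_tendsto_at_top:
  fixes u :: "real \<Rightarrow> real"
  assumes mono: "\<And>s t. R \<le> s \<Longrightarrow> s \<le> t \<Longrightarrow> u s \<le> u t"
    and bound: "\<And>t. R \<le> t \<Longrightarrow> u t \<le> B"
  obtains L where "(u \<longlongrightarrow> L) at_top"
proof
  have bdd: "bdd_above (u ` {R..})" using bound by (auto intro!: bdd_aboveI)
  show "(u \<longlongrightarrow> Sup (u ` {R..})) at_top"
  proof (rule increasing_tendsto)
    show "\<forall>\<^sub>F t in at_top. u t \<le> Sup (u ` {R..})"
      using eventually_ge_at_top[of R]
      by eventually_elim (auto intro!: cSup_upper bdd)
    fix x assume "x < Sup (u ` {R..})"
    then obtain s where s: "s \<ge> R" "x < u s"
      using less_cSup_iff[OF _ bdd] by auto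
    show "\<forall>\<^sub>F t in at_top. x < u t"
      using eventually_ge_at_top[of s]
      by eventually_elim (use mono s in \<open>meson less_le_trans\<close>)
  qed
qed


section \<open>Decay of positive solutions\<close>

text \<open>
  A positive solution of \<open>v'' = h v\<close> with \<open>h\<close> close to \<open>1\<close> is convex, so sublinear growth forces it to
  decrease. The component of \<open>v\<close> that grows is seen by \<open>g = v' + \<lambda> v\<close>, since \<open>g' \<ge> \<lambda> g\<close> as soon as
  \<open>h \<ge> \<lambda>\<^sup>2\<close>: a positive value of \<open>g\<close> would make it unbounded. Hence \<open>v' \<le> - \<lambda> v\<close>. Any \<open>\<lambda> < 1\<close> is
  possible; the later bootstrap needs \<open>2 \<lambda> + 1 > 2\<close>, and \<open>\<lambda> = 3/4\<close> is a convenient choice.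
\<close>

lemma positive_sublinear_solution_decay:
  fixes v v' h :: "real \<Rightarrow> real"
  assumes v: "\<And>r. r > 0 \<Longrightarrow> (v has_real_derivative v' r) (at r)"
    and v': "\<And>r. r > 0 \<Longrightarrow> (v' has_real_derivative h r * v r) (at r)"
    and pos: "\<And>r. r > 0 \<Longrightarrow> v r > 0"
    and h: "(h \<longlongrightarrow> 1) at_top"
    and sublin: "((\<lambda>r. v r / r) \<longlongrightarrow> 0) at_top"
  obtains A R where "A > 0" "\<And>r. r \<ge> R \<Longrightarrow> v r \<le> A * exp (- (3/4) * r)"
    "(v' \<longlongrightarrow> 0) at_top"
proof -
  have "\<forall>\<^sub>F r in at_top. h r > 9/16"
    using h by (rule order_tendstoD) simp
  then obtain R0 where R0: "\<And>r. r \<ge> R0 \<Longrightarrow> h r > 9/16"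
    by (auto simp: eventually_at_top_linorder)
  define R where "R = max 1 R0"
  have R1: "R \<ge> 1" and hR: "\<And>r. r \<ge> R \<Longrightarrow> h r > 9/16"
    using R0 by (auto simp: R_def)
  have v'_mono: "v' s \<le> v' t" if "R \<le> s" "s \<le> t" for s t
  proof (rule DERIV_nonneg_imp_nondecreasing[OF \<open>s \<le> t\<close>])
    fix x assume "s \<le> x"
    then have "x \<ge> R" "x > 0" using that R1 by auto
    moreover have "h x * v x \<ge> 0" using hR[of x] pos[of x] calculation by simp
    ultimately show "\<exists>y. (v' has_real_derivative y) (at x) \<and> 0 \<le> y"
      using v' by blast
  qed
  \<comment> \<open>By convexity, a positive slope at \<open>s\<close> would give \<open>v\<close> at least linear growth.\<close>
  have v'_nonpos: "v' s \<le> 0" if s: "R \<le> s" for s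
  proof (rule ccontr)
    assume "\<not> v' s \<le> 0"
    then have sp: "v' s > 0" by simp
    have lb: "v t \<ge> v' s * (t - s)" if "t > s" for t
    proof -
      obtain z where "z > s" "z < t" "v t - v s = (t - s) * v' z"
        using MVT2[OF \<open>t > s\<close>, of v v'] v s R1 by force
      moreover have "v' z \<ge> v' s" using v'_mono[of s z] s calculation by simp
      moreover have "(t - s) * v' z \<ge> (t - s) * v' s"
        using calculation that by (intro mult_left_mono) auto
      moreover have "v s > 0" using pos[of s] s R1 by simp
      ultimately show ?thesis unfolding mult.commute[of "v' s"] by linarith
    qed
    have "\<forall>\<^sub>F t in at_top. v t / t < v' s / 2"
      using sublin by (rule order_tendstoD) (use sp in simp)
    moreover have "\<forall>\<^sub>F t in at_top. t > 2 * s" by (rule eventually_gt_at_top)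
    ultimately have "\<forall>\<^sub>F t::real in at_top. False"
    proof eventually_elim
      case (elim t)
      have t: "t > s" "t > 0" using elim s R1 by linarith+
      have "v t < v' s / 2 * t" using elim t by (simp add: field_simps)
      moreover have "v' s * (t / 2) \<le> v' s * (t - s)"
        using sp elim by (intro mult_left_mono) auto
      ultimately show False using lb[OF t(1)] by simp
    qed
    then show False by simp
  qed
  have v_le: "v t \<le> v R" if "t \<ge> R" for t
  proof (rule DERIV_nonpos_imp_nonincreasing[OF that])
    fix x assume "R \<le> x"
    then show "\<exists>y. (v has_real_derivative y) (at x) \<and> y \<le> 0"
      using v[of x] v'_nonpos[of x] R1 by auto
  qed
  have g_nonpos: "v' s + 3/4 * v s \<le> 0" if s: "s \<ge> R" for s
  proof (rule ccontr)
    define g where "g = (\<lambda>t. v' t + 3/4 * v t)"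
    assume "\<not> v' s + 3/4 * v s \<le> 0"
    then have gs: "g s > 0" by (simp add: g_def)
    have mono: "g s * exp (- (3/4) * s) \<le> g t * exp (- (3/4) * t)" if "t \<ge> s" for t
    proof (rule DERIV_nonneg_imp_nondecreasing[OF that])
      fix x assume "s \<le> x"
      then have x: "x \<ge> R" "x > 0" using s R1 by auto
      have "((\<lambda>t. g t * exp (- (3/4) * t)) has_real_derivative
              (h x - 9/16) * v x * exp (- (3/4) * x)) (at x)"
        unfolding g_def
        by (rule derivative_eq_intros v v' x refl)+ (simp add: algebra_simps)
      moreover have "(h x - 9/16) * v x * exp (- (3/4) * x) \<ge> 0"
        using hR[OF x(1)] pos[OF x(2)] by simp
      ultimately show "\<exists>y. ((\<lambda>t. g t * exp (- (3/4) * t)) has_real_derivative y) (at x) \<and> 0 \<le> y"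
        by blast
    qed
    have "((\<lambda>t. 3/4 * v R * exp (- (3/4) * t)) \<longlongrightarrow> 0) at_top"
      by real_asymp
    then have "g s * exp (- (3/4) * s) \<le> 0"
    proof (rule tendsto_lowerbound)
      show "\<forall>\<^sub>F t in at_top. g s * exp (- (3/4) * s) \<le> 3/4 * v R * exp (- (3/4) * t)"
        using eventually_ge_at_top[of s]
      proof eventually_elim
        case (elim t)
        have "g t \<le> 3/4 * v R"
          using v'_nonpos[of t] v_le[of t] elim s by (simp add: g_def)
        then have "g t * exp (- (3/4) * t) \<le> 3/4 * v R * exp (- (3/4) * t)"
          by (intro mult_right_mono) auto
        with mono[OF elim] show ?case by linarith
      qed
    qed simp
    with gs show False by (simp add: mult_le_0_iff)
  qed
  define A where "A = v R * exp (3/4 * R)"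
  have A: "A > 0" using pos R1 by (simp add: A_def)
  have decay: "v t \<le> A * exp (- (3/4) * t)" if "t \<ge> R" for t
  proof -
    have "v t * exp (3/4 * t) \<le> v R * exp (3/4 * R)"
    proof (rule DERIV_nonpos_imp_nonincreasing[OF that])
      fix x assume x: "R \<le> x"
      have "((\<lambda>t. v t * exp (3/4 * t)) has_real_derivative
              (v' x + 3/4 * v x) * exp (3/4 * x)) (at x)"
        by (rule derivative_eq_intros v refl | (use x R1 in linarith))+ (simp add: algebra_simps)
      moreover have "(v' x + 3/4 * v x) * exp (3/4 * x) \<le> 0"
        using g_nonpos[OF x] by (simp add: mult_le_0_iff)
      ultimately show "\<exists>y. ((\<lambda>t. v t * exp (3/4 * t)) has_real_derivative y) (at x) \<and> y \<le> 0"
        by blast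
    qed
    then show ?thesis by (simp add: A_def exp_minus field_simps)
  qed
  \<comment> \<open>Since \<open>v'\<close> increases, \<open>- v' t\<close> is at most the drop of \<open>v\<close> on \<open>[t - 1, t]\<close>.\<close>
  have "(v' \<longlongrightarrow> 0) at_top"
  proof (rule tendsto_sandwich)
    show "\<forall>\<^sub>F t in at_top. - (A * exp (- (3/4) * (t - 1))) \<le> v' t"
      using eventually_ge_at_top[of "R + 1"]
    proof eventually_elim
      case (elim t)
      obtain z where z: "z > t - 1" "z < t" "v t - v (t - 1) = (t - (t - 1)) * v' z"
        using MVT2[of "t - 1" t v v'] v elim R1 by force
      have "v' z \<le> v' t" using v'_mono[of z t] z elim by simp
      moreover have "v t > 0" using pos[of t] elim R1 by simp
      ultimately show ?case using z decay[of "t - 1"] elim by simp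
    qed
    show "\<forall>\<^sub>F t in at_top. v' t \<le> 0"
      using eventually_ge_at_top[of R] by eventually_elim (rule v'_nonpos)
    show "((\<lambda>t. - (A * exp (- (3/4) * (t - 1)))) \<longlongrightarrow> 0) at_top"
      by real_asymp
  qed simp
  with that[OF A, of R] decay show thesis by simp
qed

section \<open>Comparison through the Wronskian\<close>

text \<open>
  The perturbation \<open>f = r powr (-m) * v\<close> is proportional to the solution itself, so an improved bound
  on \<open>v\<close> improves the bound on \<open>W' = - f v k\<close>. The passage from a bound on \<open>f v k\<close> to one on the
  variation of \<open>u = v / k\<close> is made once, for a majorant \<open>r powr (-p) * exp (- a r)\<close> with \<open>a > 2\<close> (the
  exponent has to beat the factor \<open>exp (2 r)\<close> coming from \<open>1 / k\<^sup>2\<close>), and used twice: with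
  \<open>p = 0, a = 5/2\<close> to bound \<open>u\<close>, then with \<open>p = m, a = 3\<close> for the sharp rate.
\<close>

lemma wronskian_comparison:
  fixes v v' k k' f h :: "real \<Rightarrow> real" and m :: real
  assumes v: "\<And>r. r > 0 \<Longrightarrow> (v has_real_derivative v' r) (at r)"
    and v': "\<And>r. r > 0 \<Longrightarrow> (v' has_real_derivative (h r - f r) * v r) (at r)"
    and k: "\<And>r. r > 0 \<Longrightarrow> (k has_real_derivative k' r) (at r)"
    and k': "\<And>r. r > 0 \<Longrightarrow> (k' has_real_derivative h r * k r) (at r)"
    and vpos: "\<And>r. r > 0 \<Longrightarrow> v r > 0" and kpos: "\<And>r. r > 0 \<Longrightarrow> k r > 0"
    and m: "m \<ge> 0" and f_def: "\<And>r. r > 0 \<Longrightarrow> f r = r powr (-m) * v r"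
    and h: "(h \<longlongrightarrow> 1) at_top" and f: "(f \<longlongrightarrow> 0) at_top"
    and sublin: "((\<lambda>r. v r / r) \<longlongrightarrow> 0) at_top"
    and k_asymp: "((\<lambda>r. k r * exp r) \<longlongrightarrow> c) at_top" and c: "c > 0"
  obtains \<kappa> C R where "\<kappa> > 0" "\<And>r. r \<ge> R \<Longrightarrow> \<bar>v r - \<kappa> * k r\<bar> \<le> C * (r powr (-m) * exp (-2 * r))"
proof -
  have "((\<lambda>r. h r - f r) \<longlongrightarrow> 1) at_top" using tendsto_diff[OF h f] by simp
  from positive_sublinear_solution_decay[OF v v' vpos this sublin]
  obtain A Rv where A: "A > 0" and Rv: "\<And>r. r \<ge> Rv \<Longrightarrow> v r \<le> A * exp (- (3/4) * r)"
    and v'_lim: "(v' \<longlongrightarrow> 0) at_top" by blast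
  have "((\<lambda>r. (k r * exp r) * (exp (- r) / r)) \<longlongrightarrow> c * 0) at_top"
    by (intro tendsto_mult k_asymp) real_asymp
  then have "((\<lambda>r. k r / r) \<longlongrightarrow> 0) at_top"
    by (simp add: exp_minus field_simps)
  from positive_sublinear_solution_decay[OF k k' kpos h this]
  have k'_lim: "(k' \<longlongrightarrow> 0) at_top" by blast
  have "\<forall>\<^sub>F r in at_top. c / 2 < k r * exp r" "\<forall>\<^sub>F r in at_top. k r * exp r < 2 * c"
    using order_tendstoD(1)[OF k_asymp, of "c / 2"] order_tendstoD(2)[OF k_asymp, of "2 * c"] c
    by simp_all
  then have "\<forall>\<^sub>F r in at_top. c / 2 < k r * exp r \<and> k r * exp r < 2 * c"
    by eventually_elim simp
  then obtain Rc where Rc: "\<And>r. r \<ge> Rc \<Longrightarrow> c / 2 < k r * exp r \<and> k r * exp r < 2 * c"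
    by (auto simp: eventually_at_top_linorder)
  define R where "R = Max {1, Rv, Rc}"
  have R1: "R \<ge> 1" and RR: "R \<ge> Rv" "R \<ge> Rc" by (auto simp: R_def)
  have Rpos: "r > 0" if "r \<ge> R" for r using that R1 by simp
  have v_decay: "v r \<le> A * exp (- (3/4) * r)" if "r \<ge> R" for r using Rv that RR by simp
  have k_upper: "k r \<le> 2 * c * exp (- r)" and k_lower: "k r \<ge> c / 2 * exp (- r)" if "r \<ge> R" for r
    using Rc[of r] that RR by (auto simp: exp_minus field_simps)
  have lim_v: "(v \<longlongrightarrow> 0) at_top"
  proof (rule tendsto_sandwich)
    show "\<forall>\<^sub>F r in at_top. 0 \<le> v r"
      using eventually_ge_at_top[of R] by eventually_elim (use vpos Rpos in force)
    show "\<forall>\<^sub>F r in at_top. v r \<le> A * exp (- (3/4) * r)"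
      using eventually_ge_at_top[of R] by eventually_elim (rule v_decay)
    show "((\<lambda>r. A * exp (- (3/4) * r)) \<longlongrightarrow> 0) at_top" by real_asymp
  qed simp
  have lim_k: "(k \<longlongrightarrow> 0) at_top"
  proof (rule tendsto_sandwich)
    show "\<forall>\<^sub>F r in at_top. 0 \<le> k r"
      using eventually_ge_at_top[of R] by eventually_elim (use kpos Rpos in force)
    show "\<forall>\<^sub>F r in at_top. k r \<le> 2 * c * exp (- r)"
      using eventually_ge_at_top[of R] by eventually_elim (rule k_upper)
    show "((\<lambda>r. 2 * c * exp (- r)) \<longlongrightarrow> 0) at_top" by real_asymp
  qed simp
  define W where "W = (\<lambda>r. v' r * k r - v r * k' r)"
  define u where "u = (\<lambda>r. v r / k r)"
  have W_lim: "(W \<longlongrightarrow> 0) at_top"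
    unfolding W_def
    using tendsto_diff[OF tendsto_mult[OF v'_lim lim_k] tendsto_mult[OF lim_v k'_lim]] by simp
  have dW: "(W has_real_derivative - (f r * v r * k r)) (at r)" if "r > 0" for r
    unfolding W_def by (rule derivative_eq_intros v v' k k' that refl)+ (simp add: algebra_simps)
  have du: "(u has_real_derivative W r / (k r)\<^sup>2) (at r)" if "r > 0" for r
    unfolding u_def W_def
    by (rule derivative_eq_intros v k that refl)+
       (use kpos[OF that] in \<open>auto simp: power2_eq_square\<close>)
  have fpos: "f r > 0" if "r > 0" for r using f_def[OF that] vpos[OF that] that by simp
  \<comment> \<open>The power factor is nonincreasing, so it survives integration of the exponential unchanged.\<close>
  have W_upper: "W r \<le> D * (r powr (-p) * exp (- a * r))"
    if D: "\<And>r. r \<ge> R \<Longrightarrow> f r * v r * k r \<le> a * D * (r powr (-p) * exp (- a * r))"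
      and ap: "a > 0" "p \<ge> 0" "D > 0" and r: "r \<ge> R" for D a p r
  proof -
    define F where "F = (\<lambda>r. W r - D * (r powr (-p) * exp (- a * r)))"
    have "F r \<le> 0"
    proof (rule le_limit_of_deriv_nonneg[OF _ _ _ r])
      fix x assume x: "R \<le> x"
      show "(F has_real_derivative
              - (f x * v x * k x) + D * ((a + p / x) * (x powr (-p) * exp (- a * x)))) (at x)"
        unfolding F_def using Rpos[OF x]
        by (auto intro!: derivative_eq_intros dW simp: powr_diff field_simps)
      have "0 \<le> D * (p / x * (x powr (-p) * exp (- a * x)))"
        using ap Rpos[OF x] by simp
      with D[OF x] show "0 \<le> - (f x * v x * k x) + D * ((a + p / x) * (x powr (-p) * exp (- a * x)))"
        by (simp add: algebra_simps)
    next
      have "((\<lambda>r. W r - D * (r powr (-p) * exp (- a * r))) \<longlongrightarrow> 0 - D * 0) at_top"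
        by (intro tendsto_intros W_lim) (use ap in real_asymp)
      then show "(F \<longlongrightarrow> 0) at_top" by (simp add: F_def)
    qed
    then show ?thesis by (simp add: F_def)
  qed
  have W_nonneg: "W r \<ge> 0" if "r \<ge> R" for r
  proof -
    have "- W r \<le> - 0"
    proof (rule le_limit_of_deriv_nonneg[OF _ _ tendsto_minus[OF W_lim] that])
      fix x assume x: "R \<le> x"
      show "((\<lambda>x. - W x) has_real_derivative f x * v x * k x) (at x)"
        using DERIV_minus[OF dW[OF Rpos[OF x]]] by simp
      show "0 \<le> f x * v x * k x"
        using fpos vpos kpos Rpos[OF x] by (simp add: less_imp_le)
    qed
    then show ?thesis by simp
  qed
  have u_mono: "u s \<le> u t" if "R \<le> s" "s \<le> t" for s t
  proof (rule DERIV_nonneg_imp_nondecreasing[OF that(2)])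
    fix x assume "s \<le> x"
    then have x: "x \<ge> R" using that by simp
    from du[OF Rpos[OF x]] W_nonneg[OF x]
    show "\<exists>y. (u has_real_derivative y) (at x) \<and> 0 \<le> y"
      by (intro exI[of _ "W x / (k x)\<^sup>2"]) simp
  qed
  have du_upper: "W r / (k r)\<^sup>2 \<le> 4 / c\<^sup>2 * D * (r powr (-p) * exp (- (a - 2) * r))"
    if "W r \<le> D * (r powr (-p) * exp (- a * r))" "r \<ge> R" for r D p a
  proof -
    have "(k r)\<^sup>2 \<ge> (c / 2 * exp (- r))\<^sup>2"
      using k_lower[OF that(2)] c by (intro power_mono) auto
    then have "W r / (k r)\<^sup>2 \<le> W r / (c / 2 * exp (- r))\<^sup>2"
      using W_nonneg[OF that(2)] c kpos[OF Rpos[OF that(2)]] by (intro divide_left_mono) auto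
    also have "\<dots> \<le> (D * (r powr (-p) * exp (- a * r))) / (c / 2 * exp (- r))\<^sup>2"
      using that by (intro divide_right_mono) auto
    also have "\<dots> = 4 / c\<^sup>2 * D * (r powr (-p) * exp (- (a - 2) * r))"
      using c by (simp add: power_mult_distrib power_divide exp_double[symmetric] field_simps
          flip: exp_add exp_diff)
    finally show ?thesis .
  qed
  have u_tail: "u r \<ge> u t - 4 / c\<^sup>2 * D / (a - 2) * (r powr (-p) * exp (- (a - 2) * r))"
    if D: "\<And>r. r \<ge> R \<Longrightarrow> f r * v r * k r \<le> a * D * (r powr (-p) * exp (- a * r))"
      and ap: "a > 2" "p \<ge> 0" "D > 0" and rt: "r \<ge> R" "t \<ge> r" for D a p r t
  proof -
    define E where "E = 4 / c\<^sup>2 * D / (a - 2)"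
    have E: "E > 0" using ap c by (simp add: E_def)
    define F where "F = (\<lambda>r. u r + E * (r powr (-p) * exp (- (a - 2) * r)))"
    have "F t \<le> F r"
    proof (rule DERIV_nonpos_imp_nonincreasing[OF rt(2)])
      fix x assume "r \<le> x"
      then have x: "x \<ge> R" using rt by simp
      have "(F has_real_derivative
          W x / (k x)\<^sup>2 - E * ((a - 2 + p / x) * (x powr (-p) * exp (- (a - 2) * x)))) (at x)"
        unfolding F_def using Rpos[OF x]
        by (auto intro!: derivative_eq_intros du simp: powr_diff field_simps)
      moreover have "W x / (k x)\<^sup>2 \<le> E * (a - 2) * (x powr (-p) * exp (- (a - 2) * x))"
        using du_upper[OF W_upper[OF D _ _ _ x] x] ap by (simp add: E_def)
      moreover have "0 \<le> E * (p / x * (x powr (-p) * exp (- (a - 2) * x)))"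
        using ap E Rpos[OF x] by simp
      ultimately show "\<exists>y. (F has_real_derivative y) (at x) \<and> y \<le> 0"
        by (intro exI[of _ "W x / (k x)\<^sup>2 -
              E * ((a - 2 + p / x) * (x powr (-p) * exp (- (a - 2) * x)))"])
          (simp add: algebra_simps)
    qed
    moreover have "0 \<le> E * (t powr (-p) * exp (- (a - 2) * t))" using E by simp
    ultimately show ?thesis unfolding F_def E_def[symmetric] by linarith
  qed
  have upos: "u r > 0" if "r \<ge> R" for r
    using vpos kpos Rpos[OF that] by (simp add: u_def)
  have rm: "r powr (-m) \<le> 1" if "r \<ge> R" for r
    using that R1 m powr_mono[of "-m" 0 r] by simp
  \<comment> \<open>The rate \<open>5/2\<close> is \<open>3/4 + 3/4 + 1\<close>, from \<open>f \<le> v\<close>, \<open>v\<close> and \<open>k\<close>.\<close>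
  have first: "f r * v r * k r \<le> 5/2 * (4/5 * A\<^sup>2 * c) * (r powr (-0) * exp (- (5/2) * r))"
    if r: "r \<ge> R" for r
  proof -
    have "f r \<le> 1 * v r"
      using f_def[OF Rpos[OF r]] rm[OF r] vpos[OF Rpos[OF r]] by simp
    then have "f r * v r * k r \<le> (A * exp (- (3/4) * r)) * (A * exp (- (3/4) * r)) * (2 * c * exp (- r))"
      using v_decay[OF r] k_upper[OF r] vpos kpos fpos Rpos[OF r] A
      by (intro mult_mono) (auto simp: less_imp_le)
    also have "\<dots> = 5/2 * (4/5 * A\<^sup>2 * c) * (r powr (-0) * exp (- (5/2) * r))"
      using Rpos[OF r] by (simp add: power2_eq_square flip: exp_add)
    finally show ?thesis .
  qed
  have "u t \<le> u R + 4 / c\<^sup>2 * (4/5 * A\<^sup>2 * c) / (5/2 - 2) * (R powr (-0) * exp (- (5/2 - 2) * R))"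
    if "t \<ge> R" for t
    using u_tail[OF first, of R t] that A c by simp
  then obtain \<kappa> where \<kappa>: "(u \<longlongrightarrow> \<kappa>) at_top"
    using bounded_increasing_tendsto_at_top[of R u] u_mono by metis
  have u_le: "u r \<le> \<kappa>" if "r \<ge> R" for r
    using \<kappa> by (rule tendsto_lowerbound)
      (use eventually_ge_at_top[of r] in \<open>eventually_elim, use u_mono that in blast\<close>, simp)
  have \<kappa>pos: "\<kappa> > 0" using upos[of R] u_le[of R] by simp
  define B where "B = 2 * c * \<kappa>"
  have B: "B > 0" using \<kappa>pos c by (simp add: B_def)
  \<comment> \<open>The bound on \<open>u\<close> upgrades the decay rate of \<open>v\<close> from \<open>3/4\<close> to the optimal \<open>1\<close>.\<close>
  have v_le: "v r \<le> B * exp (- r)" if r: "r \<ge> R" for r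
  proof -
    have "v r \<le> \<kappa> * k r"
      using u_le[OF r] kpos[OF Rpos[OF r]] by (simp add: u_def field_simps)
    also have "\<dots> \<le> \<kappa> * (2 * c * exp (- r))"
      using k_upper[OF r] \<kappa>pos by simp
    finally show ?thesis by (simp add: B_def mult_ac)
  qed
  define D where "D = 2 / 3 * B\<^sup>2 * c"
  have D: "D > 0" using B c by (simp add: D_def)
  have second: "f r * v r * k r \<le> 3 * D * (r powr (-m) * exp (- 3 * r))"
    if r: "r \<ge> R" for r
  proof -
    have "f r * v r * k r \<le> (r powr (-m) * (B * exp (- r))) * (B * exp (- r)) * (2 * c * exp (- r))"
      using v_le[OF r] k_upper[OF r] vpos kpos fpos Rpos[OF r] B f_def[OF Rpos[OF r]]
      by (intro mult_mono) (auto simp: less_imp_le)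
    also have "\<dots> = 3 * D * (r powr (-m) * (exp (- r) * exp (- r) * exp (- r)))"
      by (simp add: D_def power2_eq_square)
    also have "exp (- r) * exp (- r) * exp (- r) = exp (- 3 * r)"
      by (simp flip: exp_add)
    finally show ?thesis .
  qed
  define E where "E = 4 / c\<^sup>2 * D"
  have gap: "\<kappa> - u r \<le> E * (r powr (-m) * exp (- r))" if r: "r \<ge> R" for r
  proof -
    have "\<kappa> \<le> u r + E * (r powr (-m) * exp (- r))"
    proof (rule tendsto_upperbound[OF \<kappa>])
      show "\<forall>\<^sub>F t in at_top. u t \<le> u r + E * (r powr (-m) * exp (- r))"
        using eventually_ge_at_top[of r]
      proof eventually_elim
        case (elim t)
        show ?case using u_tail[OF second _ m D r elim] by (simp add: E_def)
      qed
    qed simp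
    then show ?thesis by simp
  qed
  have E: "E > 0" using D c by (simp add: E_def)
  show thesis
  proof (rule that[OF \<kappa>pos])
    fix r assume r: "r \<ge> R"
    have vk: "\<kappa> * k r - v r = (\<kappa> - u r) * k r"
      using kpos[OF Rpos[OF r]] by (simp add: u_def field_simps)
    then have "\<bar>v r - \<kappa> * k r\<bar> = (\<kappa> - u r) * k r"
      using u_le[OF r] kpos[OF Rpos[OF r]]
      by (metis abs_minus_commute abs_of_nonneg diff_ge_0_iff_ge less_imp_le mult_nonneg_nonneg)
    also have "\<dots> \<le> (E * (r powr (-m) * exp (- r))) * (2 * c * exp (- r))"
      using gap[OF r] k_upper[OF r] kpos[OF Rpos[OF r]] E
      by (intro mult_mono) auto
    also have "\<dots> = (2 * c * E) * (r powr (-m) * (exp (- r) * exp (- r)))"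
      by simp
    also have "exp (- r) * exp (- r) = exp (-2 * r)"
      by (simp flip: exp_add)
    finally show "\<bar>v r - \<kappa> * k r\<bar> \<le> (2 * c * E) * (r powr (-m) * exp (-2 * r))" .
  qed
qed

section \<open>Radial solutions of the ground state equation\<close>

lemma deriv_along_ray:
  assumes "F differentiable (at (r *\<^sub>R e))"
  shows "((\<lambda>t. F (t *\<^sub>R e)) has_real_derivative partial_deriv e F (r *\<^sub>R e)) (at r)"
proof -
  have F: "(F has_derivative frechet_derivative F (at (r *\<^sub>R e))) (at (r *\<^sub>R e))"
    using assms by (simp add: frechet_derivative_works)
  have "((\<lambda>t. t *\<^sub>R e) has_derivative (\<lambda>h. h *\<^sub>R e)) (at r)"
    by (auto intro!: derivative_eq_intros)
  from has_derivative_compose[OF this F]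
  have "((\<lambda>t. F (t *\<^sub>R e)) has_derivative
           (\<lambda>h. frechet_derivative F (at (r *\<^sub>R e)) (h *\<^sub>R e))) (at r)" .
  moreover have "(\<lambda>h. frechet_derivative F (at (r *\<^sub>R e)) (h *\<^sub>R e)) =
      (\<lambda>h. partial_deriv e F (r *\<^sub>R e) * h)"
    using has_derivative_linear[OF F] by (simp add: linear_cmul partial_deriv_def mult.commute)
  ultimately show ?thesis by (simp add: has_field_derivative_def)
qed

lemma partial_deriv_eqI:
  assumes "(F has_derivative D) (at x)" and "D b = d"
  shows "partial_deriv b F x = d"
  using frechet_derivative_at[OF assms(1)] assms(2) by (simp add: partial_deriv_def)

text \<open>
  The profile is the restriction of \<open>Q\<close> to the ray through a basis vector \<open>e\<close>, so its regularity is
  that of \<open>Q\<close>. At \<open>r *\<^sub>R e\<close> the second partial derivative along \<open>e\<close> is \<open>q''\<close>, and in each of the other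
  \<open>d - 1\<close> basis directions \<open>b\<close> it is \<open>q' / r\<close>: the gradient is \<open>q' (norm x) / norm x * x\<close>, and the
  derivative of the scalar factor is multiplied by \<open>e \<bullet> b = 0\<close>.
\<close>

lemma laplacian_radial:
  fixes Q :: "'a::euclidean_space \<Rightarrow> real"
  assumes smooth: "smooth Q" and rad: "radial_profile Q q"
  obtains q' q'' e where "\<And>r. r > 0 \<Longrightarrow> (q has_real_derivative q' r) (at r)"
    and "\<And>r. r > 0 \<Longrightarrow> (q' has_real_derivative q'' r) (at r)"
    and "norm e = 1"
    and "\<And>r. r > 0 \<Longrightarrow> laplacian Q (r *\<^sub>R e) = q'' r + (real DIM('a) - 1) / r * q' r"
proof -
  obtain e :: 'a where e: "e \<in> Basis" using nonempty_Basis by blast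
  have Q_diff: "Q differentiable (at x)" for x
    using smooth unfolding smooth_def by (elim allE[of _ "[]"]) simp
  have DQ_diff: "partial_deriv b Q differentiable (at x)" if "b \<in> Basis" for b x
    using smooth that unfolding smooth_def by (elim allE[of _ "[b]"]) simp
  have Qq: "Q x = q (norm x)" for x using rad by (simp add: radial_profile_def)
  define q' where "q' = (\<lambda>r. partial_deriv e Q (r *\<^sub>R e))"
  define q'' where "q'' = (\<lambda>r. partial_deriv e (partial_deriv e Q) (r *\<^sub>R e))"
  have dq: "(q has_real_derivative q' r) (at r)" if "r > 0" for r
    unfolding q'_def
  proof (rule has_field_derivative_transform_within_open[OF deriv_along_ray[OF Q_diff]])
    show "open {0::real<..}" "r \<in> {0<..}" using that by auto
    show "Q (t *\<^sub>R e) = q t" if "t \<in> {0<..}" for t using that e by (simp add: Qq)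
  qed
  have dq': "(q' has_real_derivative q'' r) (at r)" for r
    unfolding q'_def q''_def by (rule deriv_along_ray[OF DQ_diff[OF e]])
  have grad: "partial_deriv b Q x = q' (norm x) / norm x * (x \<bullet> b)" if "x \<noteq> 0" for b x
  proof (rule partial_deriv_eqI)
    have "(q has_derivative (\<lambda>h. q' (norm x) * h)) (at (norm x))"
      using dq[of "norm x"] that by (simp add: has_field_derivative_def)
    from has_derivative_compose[OF has_derivative_norm[OF that] this]
    show "(Q has_derivative (\<lambda>h. q' (norm x) * (sgn x \<bullet> h))) (at x)"
      by (simp add: Qq[abs_def] inner_commute)
    show "q' (norm x) * (sgn x \<bullet> b) = q' (norm x) / norm x * (x \<bullet> b)"
      by (simp add: sgn_div_norm field_simps)
  qed
  have tangential: "partial_deriv b (partial_deriv b Q) (r *\<^sub>R e) = q' r / r"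
    if b: "b \<in> Basis" "b \<noteq> e" and r: "r > 0" for b r
  proof (rule partial_deriv_eqI)
    let ?x = "r *\<^sub>R e"
    have x: "?x \<noteq> 0" "norm ?x = r" using r e by auto
    have "((\<lambda>t. q' t / t) has_real_derivative (q'' r * r - q' r) / (r * r)) (at r)"
      using r by (auto intro!: derivative_eq_intros dq')
    then have "((\<lambda>t. q' t / t) has_derivative (\<lambda>h. (q'' r * r - q' r) / (r * r) * h)) (at (norm ?x))"
      unfolding x by (simp only: has_field_derivative_def)
    from has_derivative_compose[OF has_derivative_norm[OF x(1)] this]
    have "((\<lambda>y. q' (norm y) / norm y * (y \<bullet> b)) has_derivative
        (\<lambda>h. q' (norm ?x) / norm ?x * (h \<bullet> b) +
              (q'' r * r - q' r) / (r * r) * (sgn ?x \<bullet> h) * (?x \<bullet> b))) (at ?x)"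
      by (intro has_derivative_eq_rhs[OF has_derivative_mult[OF _
              has_derivative_inner_left[OF has_derivative_ident]]])
         (auto simp: inner_commute)
    then show "(partial_deriv b Q has_derivative
        (\<lambda>h. q' (norm ?x) / norm ?x * (h \<bullet> b) +
              (q'' r * r - q' r) / (r * r) * (sgn ?x \<bullet> h) * (?x \<bullet> b))) (at ?x)"
      by (rule has_derivative_transform_within_open[where s = "- {0}"]) (use x grad in auto)
    show "q' (norm ?x) / norm ?x * (b \<bullet> b) +
              (q'' r * r - q' r) / (r * r) * (sgn ?x \<bullet> b) * (?x \<bullet> b) = q' r / r"
      using b e r x by (simp add: inner_Basis)
  qed
  have "laplacian Q (r *\<^sub>R e) = q'' r + (real DIM('a) - 1) / r * q' r" if r: "r > 0" for r
  proof -
    have "laplacian Q (r *\<^sub>R e) = q'' r + (\<Sum>b\<in>Basis - {e}. q' r / r)"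
      unfolding laplacian_def
      by (subst sum.remove[OF finite_Basis e]) (simp add: q''_def tangential r)
    also have "(\<Sum>b\<in>Basis - {e}. q' r / r) = (real DIM('a) - 1) / r * q' r"
      using e by (simp add: card_Diff_singleton of_nat_diff Suc_le_eq DIM_positive)
    finally show ?thesis .
  qed
  with that dq dq' e show thesis by (metis norm_Basis)
qed

lemma ground_state_profile_ode:
  fixes Q :: "'a::euclidean_space \<Rightarrow> real"
  assumes gs: "ground_state Q" and rad: "radial_profile Q q" and m: "2 * m = real DIM('a) - 1"
  obtains q' where "\<And>r. r > 0 \<Longrightarrow> (q has_real_derivative q' r) (at r)"
    and "\<And>r. r > 0 \<Longrightarrow> (q' has_real_derivative (1 - q r) * q r - 2 * m / r * q' r) (at r)"
    and "\<And>r. r > 0 \<Longrightarrow> q r > 0" and "(q \<longlongrightarrow> 0) at_top"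
proof -
  have "smooth Q" and pos: "\<And>x. Q x > 0" and lim: "(Q \<longlongrightarrow> 0) at_infinity"
    and pde: "\<And>x. - laplacian Q x + Q x - (Q x)\<^sup>2 = 0"
    using gs by (auto simp: ground_state_def)
  obtain q' q'' and e :: 'a where q: "\<And>r. r > 0 \<Longrightarrow> (q has_real_derivative q' r) (at r)"
    and q': "\<And>r. r > 0 \<Longrightarrow> (q' has_real_derivative q'' r) (at r)"
    and e: "norm e = 1"
    and lap: "\<And>r. r > 0 \<Longrightarrow> laplacian Q (r *\<^sub>R e) = q'' r + (real DIM('a) - 1) / r * q' r"
    using laplacian_radial[OF \<open>smooth Q\<close> rad] by blast
  have Qq: "Q (r *\<^sub>R e) = q r" if "r > 0" for r
    using rad e that by (simp add: radial_profile_def)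
  have q''_eq: "q'' r = (1 - q r) * q r - 2 * m / r * q' r" if "r > 0" for r
    using pde[of "r *\<^sub>R e"] unfolding lap[OF that] m[symmetric] Qq[OF that]
    by (simp add: power2_eq_square algebra_simps)
  have "filterlim (\<lambda>r. r *\<^sub>R e) at_infinity at_top"
    by (rule filterlim_norm_at_top_imp_at_infinity)
       (simp add: e filterlim_at_top_imp_at_infinity filterlim_abs_real)
  from filterlim_compose[OF lim this]
  have "(q \<longlongrightarrow> 0) at_top"
    by (rule Lim_transform_eventually)
       (use eventually_gt_at_top[of 0] in \<open>eventually_elim, simp add: Qq\<close>)
  with that q q' q''_eq pos Qq show thesis by metis
qed

section \<open>Asymptotics of radial profiles\<close>

lemma liouville_transform:
  fixes g g' p :: "real \<Rightarrow> real" and m r :: real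
  assumes g: "(g has_real_derivative g' r) (at r)"
    and g': "(g' has_real_derivative p r * g r - 2 * m / r * g' r) (at r)" and r: "r > 0"
  shows "((\<lambda>r. r powr m * g r) has_real_derivative r powr m * (g' r + m / r * g r)) (at r)"
    and "((\<lambda>r. r powr m * (g' r + m / r * g r)) has_real_derivative
            (p r + m * (m - 1) / r\<^sup>2) * (r powr m * g r)) (at r)"
proof -
  have pw: "((\<lambda>r. r powr m) has_real_derivative r powr m * (m / r)) (at r)"
    using r by (auto intro!: derivative_eq_intros simp: powr_diff)
  show "((\<lambda>r. r powr m * g r) has_real_derivative r powr m * (g' r + m / r * g r)) (at r)"
    by (rule derivative_eq_intros pw g refl)+ (simp add: algebra_simps)
  show "((\<lambda>r. r powr m * (g' r + m / r * g r)) has_real_derivative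
            (p r + m * (m - 1) / r\<^sup>2) * (r powr m * g r)) (at r)"
    by (rule derivative_eq_intros pw g g' DERIV_ident refl | (use r in simp; fail))+
       (use r in \<open>simp add: field_simps power2_eq_square\<close>)
qed

text \<open>
  The comparison is obtained in normal form near infinity; on the remaining compact interval the
  weighted difference \<open>\<phi>\<close> is bounded by continuity. The condition \<open>m \<le> 1\<close> (dimension at most three)
  makes \<open>r powr m * f\<close> sublinear, knowing only that \<open>f\<close> tends to \<open>0\<close>.
\<close>

lemma radial_decay_comparison:
  fixes f f' K K' :: "real \<Rightarrow> real" and m c :: real
  assumes f: "\<And>r. r > 0 \<Longrightarrow> (f has_real_derivative f' r) (at r)"
    and f': "\<And>r. r > 0 \<Longrightarrow> (f' has_real_derivative (1 - f r) * f r - 2 * m / r * f' r) (at r)"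
    and K: "\<And>r. r > 0 \<Longrightarrow> (K has_real_derivative K' r) (at r)"
    and K': "\<And>r. r > 0 \<Longrightarrow> (K' has_real_derivative K r - 2 * m / r * K' r) (at r)"
    and fpos: "\<And>r. r > 0 \<Longrightarrow> f r > 0" and Kpos: "\<And>r. r > 0 \<Longrightarrow> K r > 0"
    and m: "0 \<le> m" "m \<le> 1"
    and f_lim: "(f \<longlongrightarrow> 0) at_top"
    and K_asymp: "((\<lambda>r. r powr m * K r * exp r) \<longlongrightarrow> c) at_top" and c: "c > 0"
  shows "\<exists>\<kappa>>0. \<exists>C>0. \<forall>r>1. \<bar>f r - \<kappa> * K r\<bar> \<le> C * (r powr (- 2 * m) * exp (- 2 * r))"
proof -
  have sublin: "((\<lambda>r. r powr m * f r / r) \<longlongrightarrow> 0) at_top"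
  proof (rule tendsto_sandwich)
    show "\<forall>\<^sub>F r in at_top. 0 \<le> r powr m * f r / r"
      using eventually_gt_at_top[of 0]
      by eventually_elim (use fpos in \<open>simp add: less_imp_le\<close>)
    show "\<forall>\<^sub>F r in at_top. r powr m * f r / r \<le> f r"
      using eventually_ge_at_top[of 1]
    proof eventually_elim
      case (elim r)
      then have "r powr m \<le> r" using powr_mono[of m 1 r] m by simp
      then have "r powr m * f r \<le> r * f r"
        using fpos[of r] elim by (intro mult_right_mono) auto
      then show ?case using elim by (simp add: field_simps)
    qed
  qed (use f_lim in auto)
  define h where "h = (\<lambda>r::real. 1 + m * (m - 1) / r\<^sup>2)"
  have h_lim: "(h \<longlongrightarrow> 1) at_top" unfolding h_def by real_asymp
  have vpos: "r powr m * f r > 0" and kpos: "r powr m * K r > 0" if "r > 0" for r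
    using that fpos Kpos by simp_all
  have fv: "f r = r powr (- m) * (r powr m * f r)" if "r > 0" for r
    using that by (simp flip: mult.assoc powr_add)
  have v: "((\<lambda>r. r powr m * f r) has_real_derivative r powr m * (f' r + m / r * f r)) (at r)"
    if "r > 0" for r
    using liouville_transform(1)[of f f' r "\<lambda>r. 1 - f r" m] f f' that by simp
  have v': "((\<lambda>r. r powr m * (f' r + m / r * f r)) has_real_derivative
              (h r - f r) * (r powr m * f r)) (at r)" if "r > 0" for r
    using liouville_transform(2)[of f f' r "\<lambda>r. 1 - f r" m] f f' that
    by (simp add: h_def algebra_simps)
  have k': "((\<lambda>r. r powr m * (K' r + m / r * K r)) has_real_derivative
              h r * (r powr m * K r)) (at r)" if "r > 0" for r
    using liouville_transform(2)[of K K' r "\<lambda>_. 1" m] K K' that by (simp add: h_def)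
  have k: "((\<lambda>r. r powr m * K r) has_real_derivative r powr m * (K' r + m / r * K r)) (at r)"
    if "r > 0" for r
    using liouville_transform(1)[of K K' r "\<lambda>_. 1" m] K K' that by simp
  obtain \<kappa> C R where \<kappa>: "\<kappa> > 0" and R: "\<And>r. r \<ge> R \<Longrightarrow>
      \<bar>r powr m * f r - \<kappa> * (r powr m * K r)\<bar> \<le> C * (r powr (- m) * exp (- 2 * r))"
    using wronskian_comparison[OF v v' k k' vpos kpos m(1)
        fv h_lim f_lim sublin K_asymp c] by blast
  define \<phi> where "\<phi> = (\<lambda>r. r powr (2 * m) * exp (2 * r) * (f r - \<kappa> * K r))"
  have weight: "\<bar>f r - \<kappa> * K r\<bar> = \<bar>\<phi> r\<bar> * (r powr (- 2 * m) * exp (- 2 * r))" if "r > 0" for r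
  proof -
    have "r powr (2 * m) * r powr (- 2 * m) = 1" "exp (2 * r) * exp (- 2 * r) = 1"
      using that by (simp_all flip: powr_add exp_add)
    then have "\<bar>f r - \<kappa> * K r\<bar> =
        (r powr (2 * m) * r powr (- 2 * m)) * (exp (2 * r) * exp (- 2 * r)) * \<bar>f r - \<kappa> * K r\<bar>"
      by simp
    then show ?thesis
      by (simp only: \<phi>_def abs_mult abs_exp_cancel powr_ge_zero abs_of_nonneg mult_ac)
  qed
  have far: "\<bar>\<phi> r\<bar> \<le> C" if "r \<ge> R" "r > 0" for r
  proof -
    have "\<bar>\<phi> r\<bar> = r powr m * exp (2 * r) * \<bar>r powr m * f r - \<kappa> * (r powr m * K r)\<bar>"
    proof -
      have "\<phi> r = r powr m * exp (2 * r) * (r powr m * f r - \<kappa> * (r powr m * K r))"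
        using powr_add[of r m m] by (simp add: \<phi>_def algebra_simps)
      then show ?thesis by (simp add: abs_mult)
    qed
    also have "\<dots> \<le> r powr m * exp (2 * r) * (C * (r powr (- m) * exp (- 2 * r)))"
      by (intro mult_left_mono R that) simp
    also have "\<dots> = C" using that by (simp add: powr_minus exp_minus field_simps)
    finally show ?thesis .
  qed
  have "continuous_on {1..R} \<phi>"
    unfolding \<phi>_def
    by (intro continuous_intros continuous_at_imp_continuous_on ballI DERIV_isCont[OF f]
        DERIV_isCont[OF K]) auto
  then have "bounded (\<phi> ` {1..R})"
    by (intro compact_imp_bounded compact_continuous_image) auto
  then obtain M where M: "M > 0" "\<And>r. r \<in> {1..R} \<Longrightarrow> \<bar>\<phi> r\<bar> \<le> M"
    by (auto simp: bounded_pos)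
  have "\<bar>\<phi> r\<bar> \<le> max M C" if "r > 1" for r
    using M(2)[of r] far[of r] that by (cases "r \<le> R") auto
  then have "\<bar>f r - \<kappa> * K r\<bar> \<le> max M C * (r powr (- 2 * m) * exp (- 2 * r))" if "r > 1" for r
    using that weight[of r] by (simp add: mult_right_mono)
  with \<kappa> M(1) show ?thesis by (intro exI[of _ \<kappa>] conjI exI[of _ "max M C"]) auto
qed

theorem proposition1p3:
  shows "(\<forall>(Q :: real^2 \<Rightarrow> real) q K0.
            ground_state Q \<and> radial_profile Q q \<and> is_bessel_K0 K0 \<longrightarrow>
            (\<exists>\<kappa>>0. \<exists>C>0. \<forall>r>1. \<bar>q r - \<kappa> * K0 r\<bar> \<le> C * (exp (- 2 * r) / r))) \<and>
         (\<forall>(Q :: real^3 \<Rightarrow> real) q.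
            ground_state Q \<and> radial_profile Q q \<longrightarrow>
            (\<exists>\<kappa>>0. \<exists>C>0. \<forall>r>1. \<bar>q r - \<kappa> * (exp (- r) / r)\<bar> \<le> C * (exp (- r) / r\<^sup>2)))"
proof (intro conjI allI impI; elim conjE)
  fix Q :: "real^2 \<Rightarrow> real" and q K0
  assume gs: "ground_state Q" "radial_profile Q q" and "is_bessel_K0 K0"
  then obtain K' K'' where K: "\<And>r. r > 0 \<Longrightarrow> (K0 has_real_derivative K' r) (at r)"
      "\<And>r. r > 0 \<Longrightarrow> (K' has_real_derivative K'' r) (at r)"
      "\<And>r. r > 0 \<Longrightarrow> K'' r + 1 / r * K' r - K0 r = 0"
    and Kpos: "\<And>r. r > 0 \<Longrightarrow> K0 r > 0"
    and asymp: "K0 \<sim>[at_top] (\<lambda>r. sqrt (pi / 2) * r powr (-1/2) * exp (- r))"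
    unfolding is_bessel_K0_def by blast
  have K': "(K' has_real_derivative K0 r - 2 * (1/2) / r * K' r) (at r)" if "r > 0" for r
  proof -
    have "K'' r = K0 r - 2 * (1/2) / r * K' r" using K(3)[OF that] by simp
    with K(2)[OF that] show ?thesis by simp
  qed
  have "((\<lambda>r. K0 r / (sqrt (pi / 2) * r powr (-1/2) * exp (- r))) \<longlongrightarrow> 1) at_top"
    by (rule asymp_equivD_strong[OF asymp])
       (use eventually_gt_at_top[of 0] in \<open>eventually_elim, simp\<close>)
  from tendsto_mult[OF tendsto_const[of "sqrt (pi / 2)"] this]
  have "((\<lambda>r. sqrt (pi / 2) * (K0 r / (sqrt (pi / 2) * r powr (-1/2) * exp (- r))))
           \<longlongrightarrow> sqrt (pi / 2)) at_top"
    by simp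
  then have "((\<lambda>r. r powr (1/2) * K0 r * exp r) \<longlongrightarrow> sqrt (pi / 2)) at_top"
    by (rule Lim_transform_eventually)
       (use eventually_gt_at_top[of 0] in
         \<open>eventually_elim, simp add: powr_minus exp_minus field_simps\<close>)
  moreover obtain q' where "\<And>r. r > 0 \<Longrightarrow> (q has_real_derivative q' r) (at r)"
    and "\<And>r. r > 0 \<Longrightarrow> (q' has_real_derivative (1 - q r) * q r - 2 * (1/2) / r * q' r) (at r)"
    and "\<And>r. r > 0 \<Longrightarrow> q r > 0" and "(q \<longlongrightarrow> 0) at_top"
    using ground_state_profile_ode[OF gs, of "1/2"] by auto
  ultimately obtain \<kappa> C where "\<kappa> > 0" "C > 0"
      "\<And>r. r > 1 \<Longrightarrow> \<bar>q r - \<kappa> * K0 r\<bar> \<le> C * (r powr (- 2 * (1/2)) * exp (- 2 * r))"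
    using radial_decay_comparison[of q q' "1/2" K0 K' "sqrt (pi / 2)"] K(1) K' Kpos by auto
  then show "\<exists>\<kappa>>0. \<exists>C>0. \<forall>r>1. \<bar>q r - \<kappa> * K0 r\<bar> \<le> C * (exp (- 2 * r) / r)"
    by (intro exI[of _ \<kappa>] exI[of _ C] conjI) (auto simp: powr_minus field_simps)
next
  fix Q :: "real^3 \<Rightarrow> real" and q
  assume gs: "ground_state Q" "radial_profile Q q"
  obtain q' where q: "\<And>r. r > 0 \<Longrightarrow> (q has_real_derivative q' r) (at r)"
    "\<And>r. r > 0 \<Longrightarrow> (q' has_real_derivative (1 - q r) * q r - 2 * 1 / r * q' r) (at r)"
    "\<And>r. r > 0 \<Longrightarrow> q r > 0" "(q \<longlongrightarrow> 0) at_top"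
    using ground_state_profile_ode[OF gs, of 1] by auto
  define K K' :: "real \<Rightarrow> real"
    where "K = (\<lambda>r. exp (- r) / r)" and "K' = (\<lambda>r. - exp (- r) / r - exp (- r) / r\<^sup>2)"
  have K: "(K has_real_derivative K' r) (at r)" if "r > 0" for r
    unfolding K_def K'_def using that
    by (auto intro!: derivative_eq_intros simp: field_simps power2_eq_square)
  have K': "(K' has_real_derivative K r - 2 * 1 / r * K' r) (at r)" if "r > 0" for r
    unfolding K_def K'_def using that
    by (auto intro!: derivative_eq_intros simp: field_simps power2_eq_square)
  have K_asymp: "((\<lambda>r. r powr 1 * K r * exp r) \<longlongrightarrow> 1) at_top"
    unfolding K_def by real_asymp
  have "K r > 0" if "r > 0" for r using that by (simp add: K_def)
  then obtain \<kappa> C where \<kappa>: "\<kappa> > 0" and C: "C > 0"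
      "\<And>r. r > 1 \<Longrightarrow> \<bar>q r - \<kappa> * K r\<bar> \<le> C * (r powr (- 2 * 1) * exp (- 2 * r))"
    using radial_decay_comparison[OF q(1,2) K K' q(3) _ _ _ q(4) K_asymp] by auto
  have "\<bar>q r - \<kappa> * (exp (- r) / r)\<bar> \<le> C * (exp (- r) / r\<^sup>2)" if "r > 1" for r
  proof -
    have "\<bar>q r - \<kappa> * (exp (- r) / r)\<bar> \<le> C * (exp (- 2 * r) / r\<^sup>2)"
      using C(2)[OF that] that by (simp add: K_def powr_minus field_simps)
    also have "\<dots> \<le> C * (exp (- r) / r\<^sup>2)"
      using C(1) that by (intro mult_left_mono divide_right_mono) auto
    finally show ?thesis .
  qed
  with \<kappa> C(1) show "\<exists>\<kappa>>0. \<exists>C>0. \<forall>r>1. \<bar>q r - \<kappa> * (exp (- r) / r)\<bar> \<le> C * (exp (- r) / r\<^sup>2)"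
    by blast
qed

end
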